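(* Let $0\le\alpha<1$ and let $p\ge q\ge2$ and $n$ be integers with $p+q\le n-2$. Then $\lambda_\alpha(B^5_{n-1,p,q})>\lambda_\alpha(B^1_{n,p,q})$.
   Context: All digraphs are simple. For a digraph $G$, $A(G)$ is its adjacency matrix and $D(G)$ the diagonal matrix of outdegrees; $A_\alpha(G)=\alpha D(G)+(1-\alpha)A(G)$ and $\lambda_\alpha(G)$ is the largest modulus of an eigenvalue of $A_\alpha(G)$. $\overleftrightarrow{K_{p,q}}$ is the complete bipartite digraph obtained from $K_{p,q}$ by replacing each edge with a pair of opposite arcs, with parts $V_p=\{v_1,\ldots,v_p\}$ and $V_q=\{v_{p+1},\ldots,v_{p+q}\}$. For $m\ge p+q+1$, with new vertices $v_{p+q+1},\ldots,v_m$: $B^1_{m,p,q}$ is obtained from $\overleftrightarrow{K_{p,q}}$ by adding the directed path $v_1v_{p+q+1}\cdots v_mv_p$, and $B^5_{m,p,q}$ by adding the directed path $v_1v_{p+q+1}\cdots v_mv_{p+1}$. *)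

theory Defs
  imports
    "Graph_Theory.Graph_Theory"
    "Jordan_Normal_Form.Spectral_Radius"
begin

text \<open>A simple digraph is represented as a set of vertices with a set of ordered pairs as arcs, so
  parallel arcs cannot occur. Rows and columns of the matrices below are indexed by the vertices in
  increasing order; the spectrum does not depend on this order.\<close>

definition vertex_at :: "('a::linorder) pair_pre_digraph \<Rightarrow> nat \<Rightarrow> 'a" where
  "vertex_at G i = sorted_list_of_set (pverts G) ! i"

definition adjacency_mat :: "('a::linorder) pair_pre_digraph \<Rightarrow> real mat" where
  "adjacency_mat G = mat (card (pverts G)) (card (pverts G))
     (\<lambda>(i, j). if (vertex_at G i, vertex_at G j) \<in> parcs G then 1 else 0)"

definition outdegree_mat :: "('a::linorder) pair_pre_digraph \<Rightarrow> real mat" where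
  "outdegree_mat G = mat (card (pverts G)) (card (pverts G))
     (\<lambda>(i, j). if i = j then real (out_degree (with_proj G) (vertex_at G i)) else 0)"

definition A_alpha :: "real \<Rightarrow> ('a::linorder) pair_pre_digraph \<Rightarrow> real mat" where
  "A_alpha \<alpha> G = \<alpha> \<cdot>\<^sub>m outdegree_mat G + (1 - \<alpha>) \<cdot>\<^sub>m adjacency_mat G"

definition lambda_alpha :: "real \<Rightarrow> ('a::linorder) pair_pre_digraph \<Rightarrow> real" where
  "lambda_alpha \<alpha> G = spectral_radius (map_mat complex_of_real (A_alpha \<alpha> G))"

text \<open>The vertex \<open>v\<^sub>i\<close> is represented by the number \<open>i\<close>, starting from 1.\<close>

definition complete_bipartite :: "nat \<Rightarrow> nat \<Rightarrow> nat pair_pre_digraph" where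
  "complete_bipartite p q =
     \<lparr> pverts = {1..p + q},
       parcs = {1..p} \<times> {p + 1..p + q} \<union> {p + 1..p + q} \<times> {1..p} \<rparr>"

definition add_dipath :: "'a list \<Rightarrow> 'a pair_pre_digraph \<Rightarrow> 'a pair_pre_digraph" where
  "add_dipath xs G =
     \<lparr> pverts = pverts G \<union> set xs, parcs = parcs G \<union> set (vwalk_arcs xs) \<rparr>"

definition B1 :: "nat \<Rightarrow> nat \<Rightarrow> nat \<Rightarrow> nat pair_pre_digraph" where
  "B1 m p q = add_dipath (1 # [p + q + 1..<m + 1] @ [p]) (complete_bipartite p q)"

definition B5 :: "nat \<Rightarrow> nat \<Rightarrow> nat \<Rightarrow> nat pair_pre_digraph" where
  "B5 m p q = add_dipath (1 # [p + q + 1..<m + 1] @ [p + 1]) (complete_bipartite p q)"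

lemma complete_bipartite_K: "complete_bipartite_digraph p q (with_proj (complete_bipartite p q))"
  unfolding complete_bipartite_digraph_pair_def
  by (intro conjI exI[of _ "{1..p}"] exI[of _ "{p + 1..p + q}"])
    (auto simp: complete_bipartite_def)

lemma vwalk_arcs_chain:
  "set (vwalk_arcs (x # [a..<Suc b] @ [y])) =
     (if a \<le> b then {(x, a), (b, y)} \<union> {(k, Suc k) | k. a \<le> k \<and> k < b} else {(x, y)})"
proof (induction "Suc b - a" arbitrary: x a)
  case 0
  then show ?case by simp
next
  case (Suc n)
  then have ab: "a \<le> b" by simp
  have IH: "set (vwalk_arcs (a # [Suc a..<Suc b] @ [y])) =
     (if Suc a \<le> b then {(a, Suc a), (b, y)} \<union> {(k, Suc k) | k. Suc a \<le> k \<and> k < b} else {(a, y)})"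
    using Suc(2) by (intro Suc(1)) simp
  have "[a..<Suc b] = a # [Suc a..<Suc b]" using ab by (simp add: upt_conv_Cons)
  then have "set (vwalk_arcs (x # [a..<Suc b] @ [y])) =
      insert (x, a) (set (vwalk_arcs (a # [Suc a..<Suc b] @ [y])))"
    by simp
  also have "\<dots> = {(x, a), (b, y)} \<union> {(k, Suc k) | k. a \<le> k \<and> k < b}"
    unfolding IH using ab by (auto simp: le_less Suc_le_eq)
  finally show ?case using ab by simp
qed

lemma pair_digraph_B1:
  assumes "2 \<le> p" "1 \<le> q" "p + q + 1 \<le> m"
  shows "pverts (B1 m p q) = {1..m}" and "pair_digraph (B1 m p q)"
proof -
  show v: "pverts (B1 m p q) = {1..m}"
    using assms by (auto simp: B1_def add_dipath_def complete_bipartite_def)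
  have a: "parcs (B1 m p q) = parcs (complete_bipartite p q) \<union>
      ({(1, p + q + 1), (m, p)} \<union> {(k, Suc k) | k. p + q + 1 \<le> k \<and> k < m})"
    using assms vwalk_arcs_chain[of 1 "p + q + 1" m p] by (simp add: B1_def add_dipath_def)
  show "pair_digraph (B1 m p q)"
    by unfold_locales (use assms in \<open>auto simp: v a complete_bipartite_def
       intro!: finite_subset[of "{(k, Suc k) | k. Suc (p + q) \<le> k \<and> k < m}" "{1..m}\<times>{1..m}"]\<close>)
qed

lemma pair_digraph_B5:
  assumes "2 \<le> p" "1 \<le> q" "p + q + 1 \<le> m"
  shows "pverts (B5 m p q) = {1..m}" and "pair_digraph (B5 m p q)"
proof -
  show v: "pverts (B5 m p q) = {1..m}"
    using assms by (auto simp: B5_def add_dipath_def complete_bipartite_def)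
  have a: "parcs (B5 m p q) = parcs (complete_bipartite p q) \<union>
      ({(1, p + q + 1), (m, p + 1)} \<union> {(k, Suc k) | k. p + q + 1 \<le> k \<and> k < m})"
    using assms vwalk_arcs_chain[of 1 "p + q + 1" m "p + 1"] by (simp add: B5_def add_dipath_def)
  show "pair_digraph (B5 m p q)"
    by unfold_locales (use assms in \<open>auto simp: v a complete_bipartite_def
       intro!: finite_subset[of "{(k, Suc k) | k. Suc (p + q) \<le> k \<and> k < m}" "{1..m}\<times>{1..m}"]\<close>)
qed

end

theory Submission
  imports Defs
begin

text \<open>A positive eigenvector of \<open>A\<^sub>\<alpha>\<close> determines \<open>\<lambda>\<^sub>\<alpha>\<close>. On both digraphs such an eigenvector can be
  written down as a function of the eigenvalue \<open>\<mu>\<close>: with entry 1 on \<open>V\<^sub>q\<close>, entries along the added path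
  grow by the factor \<open>(\<mu> - \<alpha>)/(1 - \<alpha>)\<close>, and everything reduces to one scalar equation, in which the
  two digraphs differ only in the entry at the first path vertex. At the root for \<open>B\<^sup>1\<close> that entry is
  strictly larger for \<open>B\<^sup>5\<close>, since \<open>(\<mu> - \<alpha>)(\<mu> - \<alpha>q) > (1 - \<alpha>)\<^sup>2q\<close>; hence the equation for \<open>B\<^sup>5\<close>
  has a larger root, by the intermediate value theorem.\<close>

section \<open>Spectral radius from a positive eigenvector\<close>

text \<open>A maximum principle: for any complex eigenvector \<open>v\<close>, the row in which
  \<open>norm (v $ i) / x i\<close> is largest bounds the modulus of its eigenvalue by
  \<open>\<mu>\<close>.\<close>

lemma spectral_radius_pos_eigenvector:
  fixes A :: "real mat" and x :: "nat \<Rightarrow> real"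
  assumes A: "A \<in> carrier_mat n n" and n: "0 < n"
    and nonneg: "\<And>i j. i < n \<Longrightarrow> j < n \<Longrightarrow> 0 \<le> A $$ (i, j)"
    and pos: "\<And>i. i < n \<Longrightarrow> 0 < x i"
    and eig: "\<And>i. i < n \<Longrightarrow> (\<Sum>j<n. A $$ (i, j) * x j) = \<mu> * x i"
  shows "spectral_radius (map_mat complex_of_real A) = \<mu>"
proof (rule antisym)
  let ?A = "map_mat complex_of_real A"
  have cA: "?A \<in> carrier_mat n n" using A by simp
  have mult: "(?A *\<^sub>v v) $ i = (\<Sum>j<n. complex_of_real (A $$ (i, j)) * v $ j)"
    if "i < n" "v \<in> carrier_vec n" for v i
    using that A by (auto simp: scalar_prod_def atLeast0LessThan intro!: sum.cong)
  have "0 \<le> \<mu> * x 0"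
    unfolding eig[OF n, symmetric] using nonneg[OF n] pos
    by (intro sum_nonneg mult_nonneg_nonneg) (auto intro: less_imp_le)
  then have mu: "0 \<le> \<mu>" using pos[OF n] by (simp add: zero_le_mult_iff)
  show "\<mu> \<le> spectral_radius ?A"
  proof -
    define v where "v = vec n (\<lambda>i. complex_of_real (x i))"
    have v: "v \<in> carrier_vec n" by (simp add: v_def)
    have "v $ 0 \<noteq> 0\<^sub>v n $ 0" using n pos[OF n] by (simp add: v_def)
    then have v0: "v \<noteq> 0\<^sub>v n" by metis
    have "?A *\<^sub>v v = complex_of_real \<mu> \<cdot>\<^sub>v v"
    proof (rule eq_vecI)
      fix i assume "i < dim_vec (complex_of_real \<mu> \<cdot>\<^sub>v v)"
      then have i: "i < n" by (simp add: v_def)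
      have "(?A *\<^sub>v v) $ i = complex_of_real (\<Sum>j<n. A $$ (i, j) * x j)"
        unfolding mult[OF i v] by (simp add: v_def)
      then show "(?A *\<^sub>v v) $ i = (complex_of_real \<mu> \<cdot>\<^sub>v v) $ i"
        using i by (simp add: eig v_def)
    qed (use A in \<open>simp add: v_def\<close>)
    then have "complex_of_real \<mu> \<in> spectrum ?A"
      using v v0 A unfolding spectrum_def eigenvalue_def eigenvector_def by auto
    then have "norm (complex_of_real \<mu>) \<in> norm ` spectrum ?A" by blast
    then show ?thesis using spectral_radius_mem_max(2)[OF cA n] mu by fastforce
  qed
  show "spectral_radius ?A \<le> \<mu>"
  proof -
    obtain k where k: "k \<in> spectrum ?A" and sr: "spectral_radius ?A = norm k"
      using spectral_radius_mem_max(1)[OF cA n] by auto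
    obtain v where v: "v \<in> carrier_vec n" and v0: "v \<noteq> 0\<^sub>v n" and ev: "?A *\<^sub>v v = k \<cdot>\<^sub>v v"
      using k A unfolding spectrum_def eigenvalue_def eigenvector_def by auto
    \<comment> \<open>Comparing \<open>v\<close> with \<open>x\<close> through these ratios lets the
      triangle inequality in a maximising row \<open>i\<close> reproduce the eigenvector equation of
      \<open>x\<close>, scaled by \<open>r i\<close>.\<close>
    define r where "r i = norm (v $ i) / x i" for i
    have "\<exists>i\<in>{..<n}. \<forall>j\<in>{..<n}. r j \<le> r i"
      using n Max_in[of "r ` {..<n}"] Max_ge[of "r ` {..<n}"]
      by (metis (no_types, lifting) empty_iff finite_imageI finite_lessThan image_iff image_is_empty
          lessThan_iff)
    then obtain i where i: "i < n" and mx: "\<And>j. j < n \<Longrightarrow> r j \<le> r i" by auto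
    have nv: "norm (v $ j) = r j * x j" if "j < n" for j
      using pos[OF that] by (simp add: r_def)
    \<comment> \<open>Positivity of the maximum is where \<open>v\<close> being nonzero enters; it
      allows \<open>norm (v $ i)\<close> to be cancelled at the end.\<close>
    have ri: "0 < r i"
    proof (rule ccontr)
      assume "\<not> 0 < r i"
      then have "v $ j = 0" if "j < n" for j
        using mx[OF that] nv[OF that] pos[OF that]
        by (metis linorder_not_less mult_nonneg_nonpos2 norm_le_zero_iff order.trans less_imp_le)
      then have "v = 0\<^sub>v n" using v by (intro eq_vecI) auto
      then show False using v0 by contradiction
    qed
    have "norm k * norm (v $ i) = norm ((?A *\<^sub>v v) $ i)"
      using i v by (simp add: ev norm_mult)
    also have "\<dots> \<le> (\<Sum>j<n. A $$ (i, j) * (r j * x j))"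
      unfolding mult[OF i v]
      by (rule order.trans[OF norm_sum], rule sum_mono) (use nonneg i in \<open>simp add: norm_mult nv\<close>)
    also have "\<dots> \<le> (\<Sum>j<n. A $$ (i, j) * (r i * x j))"
      using nonneg i pos mx by (intro sum_mono mult_left_mono mult_right_mono) (auto intro: less_imp_le)
    also have "\<dots> = r i * (\<Sum>j<n. A $$ (i, j) * x j)"
      by (simp add: sum_distrib_left mult_ac)
    also have "\<dots> = \<mu> * norm (v $ i)"
      using i by (simp add: eig nv)
    finally show ?thesis
      using ri pos[OF i] by (simp add: sr nv[OF i])
  qed
qed

text \<open>Eliminates the enumeration of the vertices: what remains to check is one equation per
  vertex, involving only its out-neighbours.\<close>

lemma lambda_alpha_pos_eigenvector:
  fixes G :: "'a::linorder pair_pre_digraph" and f :: "'a \<Rightarrow> real" and \<alpha> \<mu> :: real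
  assumes G: "pair_fin_digraph G" and \<alpha>: "0 \<le> \<alpha>" "\<alpha> \<le> 1" and V: "pverts G \<noteq> {}"
    and pos: "\<And>v. v \<in> pverts G \<Longrightarrow> 0 < f v"
    and eig: "\<And>v. v \<in> pverts G \<Longrightarrow>
      \<alpha> * real (card {w. (v, w) \<in> parcs G}) * f v + (1 - \<alpha>) * (\<Sum>w | (v, w) \<in> parcs G. f w) = \<mu> * f v"
  shows "lambda_alpha \<alpha> G = \<mu>"
proof -
  interpret pair_fin_digraph G by fact
  define n where "n = card (pverts G)"
  have n: "0 < n" using V by (simp add: n_def card_gt_0_iff)
  have bij: "bij_betw (vertex_at G) {..<n} (pverts G)"
    unfolding vertex_at_def by (rule bij_betw_nth) (auto simp: n_def)
  have mem: "vertex_at G i \<in> pverts G" if "i < n" for i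
    using bij_betwE[OF bij] that by simp
  have deg: "out_degree (with_proj G) v = card {w. (v, w) \<in> parcs G}" for v
  proof -
    have "out_arcs (with_proj G) v = Pair v ` {w. (v, w) \<in> parcs G}"
      by (auto simp: out_arcs_def)
    then show ?thesis
      by (simp add: out_degree_def card_image inj_on_def)
  qed
  have entry: "A_alpha \<alpha> G $$ (i, j) =
      (if i = j then \<alpha> * real (card {w. (vertex_at G i, w) \<in> parcs G}) else 0) +
      (if (vertex_at G i, vertex_at G j) \<in> parcs G then 1 - \<alpha> else 0)" if "i < n" "j < n" for i j
    using that unfolding n_def
    by (auto simp: A_alpha_def outdegree_mat_def adjacency_mat_def deg)
  have "spectral_radius (map_mat complex_of_real (A_alpha \<alpha> G)) = \<mu>"
  proof (rule spectral_radius_pos_eigenvector[where x = "\<lambda>i. f (vertex_at G i)"])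
    show "A_alpha \<alpha> G \<in> carrier_mat n n"
      by (simp add: A_alpha_def outdegree_mat_def adjacency_mat_def n_def)
    show "0 \<le> A_alpha \<alpha> G $$ (i, j)" if "i < n" "j < n" for i j
      using that \<alpha> by (simp add: entry)
    show "(\<Sum>j<n. A_alpha \<alpha> G $$ (i, j) * f (vertex_at G j)) = \<mu> * f (vertex_at G i)"
      if i: "i < n" for i
    proof -
      let ?v = "vertex_at G i"
      have "(\<Sum>j<n. A_alpha \<alpha> G $$ (i, j) * f (vertex_at G j)) =
          (\<Sum>j<n. if i = j then \<alpha> * real (card {w. (?v, w) \<in> parcs G}) * f ?v else 0) +
          (\<Sum>j<n. if (?v, vertex_at G j) \<in> parcs G then (1 - \<alpha>) * f (vertex_at G j) else 0)"
        unfolding sum.distrib[symmetric]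
        by (rule sum.cong) (use i in \<open>auto simp: entry algebra_simps\<close>)
      also have "(\<Sum>j<n. if (?v, vertex_at G j) \<in> parcs G then (1 - \<alpha>) * f (vertex_at G j) else 0) =
          (\<Sum>w\<in>pverts G. if (?v, w) \<in> parcs G then (1 - \<alpha>) * f w else 0)"
        by (rule sum.reindex_bij_betw[OF bij])
      also have "\<dots> = (\<Sum>w | (?v, w) \<in> parcs G. (1 - \<alpha>) * f w)"
        by (rule sum.mono_neutral_cong_right) (auto dest: in_arcsD2)
      finally show ?thesis
        using i eig[OF mem[OF i]] by (simp add: sum_distrib_left)
    qed
  qed (use n pos mem in auto)
  then show ?thesis by (simp add: lambda_alpha_def)
qed

section \<open>The eigenvector and its scalar equation\<close>

text \<open>Treats both families at once: \<open>e = p\<close> gives \<open>B1\<close> and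
  \<open>e = p + 1\<close> gives \<open>B5\<close>.\<close>

definition bipartite_dipath :: "nat \<Rightarrow> nat \<Rightarrow> nat \<Rightarrow> nat \<Rightarrow> nat pair_pre_digraph" where
  "bipartite_dipath m p q e = add_dipath (1 # [p + q + 1..<m + 1] @ [e]) (complete_bipartite p q)"

text \<open>The ratio of the entry \<open>k\<close> arcs before the end \<open>e\<close> of the
  added path to the entry at \<open>e\<close>, for vertices inside the path.\<close>

definition dipath_weight :: "real \<Rightarrow> nat \<Rightarrow> real \<Rightarrow> real" where
  "dipath_weight \<alpha> k \<mu> = ((1 - \<alpha>) / (\<mu> - \<alpha>)) ^ k"

text \<open>The eigenvector equations for eigenvalue \<open>\<mu>\<close>, normalised to entry 1 on \<open>V\<^sub>q\<close>, all follow by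
  elimination except the one at \<open>V\<^sub>q\<close> itself, which says that the defect vanishes; here \<open>g\<close> is the
  entry at the first vertex of the added path.\<close>

definition eigen_defect :: "real \<Rightarrow> nat \<Rightarrow> nat \<Rightarrow> real \<Rightarrow> real \<Rightarrow> real" where
  "eigen_defect \<alpha> p q g \<mu> = \<mu> - \<alpha> * p - (1 - \<alpha>)\<^sup>2 * (q + g) / (\<mu> - \<alpha> * (real q + 1))
     - (1 - \<alpha>)\<^sup>2 * (real p - 1) * q / (\<mu> - \<alpha> * q)"

text \<open>Here \<open>c\<close> is the entry at \<open>e\<close>, which depends only on the side
  containing \<open>e\<close> because \<open>e\<close> is not the exceptional vertex 1. The lower
  bound on \<open>\<mu>\<close> makes all denominators, hence all entries, positive.\<close>

lemma lambda_alpha_bipartite_dipath: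
  fixes \<alpha> \<mu> c :: real
  assumes \<alpha>: "0 \<le> \<alpha>" "\<alpha> < 1" and p: "2 \<le> p" and q: "1 \<le> q" and m: "p + q + 1 \<le> m"
    and e: "2 \<le> e" "e \<le> p + q"
    and \<mu>: "\<alpha> * (real q + 1) < \<mu>"
    and c: "c = (if e \<le> p then (1 - \<alpha>) * q / (\<mu> - \<alpha> * q) else 1)"
    and root: "eigen_defect \<alpha> p q (dipath_weight \<alpha> (m - (p + q)) \<mu> * c) \<mu> = 0"
  shows "lambda_alpha \<alpha> (bipartite_dipath m p q e) = \<mu>"
proof -
  let ?G = "bipartite_dipath m p q e"
  have V: "pverts ?G = {1..m}"
    using e m by (auto simp: bipartite_dipath_def add_dipath_def complete_bipartite_def)
  have E: "parcs ?G = parcs (complete_bipartite p q) \<union>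
      ({(1, p + q + 1), (m, e)} \<union> {(k, Suc k) | k. p + q + 1 \<le> k \<and> k < m})"
    using m vwalk_arcs_chain[of 1 "p + q + 1" m e] by (simp add: bipartite_dipath_def add_dipath_def)
  have G: "pair_fin_digraph ?G"
    by unfold_locales (use p q m e in \<open>auto simp: V E complete_bipartite_def
       intro!: finite_subset[of "{(k, Suc k) | k. Suc (p + q) \<le> k \<and> k < m}" "{1..m}\<times>{1..m}"]\<close>)
  have out_1: "{w. (1, w) \<in> parcs ?G} = insert (p + q + 1) {p + 1..p + q}"
    using p m by (auto simp: E complete_bipartite_def)
  have out_p: "{w. (v, w) \<in> parcs ?G} = {p + 1..p + q}" if "2 \<le> v" "v \<le> p" for v
    using that m by (auto simp: E complete_bipartite_def)
  have out_q: "{w. (v, w) \<in> parcs ?G} = {1..p}" if "p < v" "v \<le> p + q" for v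
    using that p m by (auto simp: E complete_bipartite_def)
  have out_path: "{w. (v, w) \<in> parcs ?G} = {v + 1}" if "p + q < v" "v < m" for v
    using that p by (auto simp: E complete_bipartite_def)
  have out_m: "{w. (m, w) \<in> parcs ?G} = {e}"
    using p m by (auto simp: E complete_bipartite_def)
  \<comment> \<open>\<open>t\<close> is the ratio of a path vertex to its successor,
    \<open>x\<close> the entry on \<open>V_p\<close> apart from vertex 1, \<open>g\<close> the entry
    at the first path vertex and \<open>x1\<close> the entry at vertex 1; each solves its own
    eigenvector equation.\<close>
  define t where "t = (1 - \<alpha>) / (\<mu> - \<alpha>)"
  define x where "x = (1 - \<alpha>) * q / (\<mu> - \<alpha> * q)"
  define g where "g = t ^ (m - (p + q)) * c"
  define x1 where "x1 = (1 - \<alpha>) * (q + g) / (\<mu> - \<alpha> * (real q + 1))"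
  \<comment> \<open>The exponent counts the arcs from \<open>v\<close> to \<open>e\<close>: it is 1
    at \<open>m\<close> and \<open>m - (p + q)\<close> at the first path vertex.\<close>
  define f where "f v = (if v = 1 then x1 else if v \<le> p then x else if v \<le> p + q then 1
    else t ^ (m + 1 - v) * c)" for v
  have "\<alpha> * q \<le> \<alpha> * (real q + 1)" "\<alpha> \<le> \<alpha> * (real q + 1)"
    using \<alpha> by (simp_all add: algebra_simps)
  then have \<mu>': "\<alpha> * q < \<mu>" "\<alpha> < \<mu>" using \<mu> by linarith+
  have t: "0 < t" using \<alpha> \<mu>' by (simp add: t_def)
  have x: "0 < x" using \<alpha> \<mu>' q by (simp add: x_def)
  have c': "c = f e" using e by (simp add: c f_def x_def)
  have c0: "0 < c" using x by (simp add: c x_def)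
  have g: "0 < g" using t c0 by (simp add: g_def)
  have x1: "0 < x1" using \<alpha> \<mu> g by (simp add: x1_def)
  have teq: "\<alpha> * t + (1 - \<alpha>) = \<mu> * t" using \<mu>' by (simp add: t_def field_simps)
  have xeq: "\<alpha> * q * x + (1 - \<alpha>) * q = \<mu> * x" using \<mu>' by (simp add: x_def field_simps)
  have x1eq: "\<alpha> * (real q + 1) * x1 + (1 - \<alpha>) * (q + g) = \<mu> * x1"
    using \<mu> by (simp add: x1_def field_simps)
  \<comment> \<open>The equation on \<open>V_q\<close>, the only one that constrains
    \<open>\<mu>\<close>.\<close>
  have zeq: "\<alpha> * p + (1 - \<alpha>) * (x1 + (real p - 1) * x) = \<mu>"
  proof -
    have "eigen_defect \<alpha> p q g \<mu> = 0" using root by (simp add: dipath_weight_def g_def t_def)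
    then have "\<mu> = \<alpha> * p + (1 - \<alpha>)\<^sup>2 * (q + g) / (\<mu> - \<alpha> * (real q + 1))
        + (1 - \<alpha>)\<^sup>2 * (real p - 1) * q / (\<mu> - \<alpha> * q)"
      unfolding eigen_defect_def by linarith
    also have "\<dots> = \<alpha> * p + (1 - \<alpha>) * (x1 + (real p - 1) * x)"
      by (simp add: x1_def x_def power2_eq_square distrib_left mult_ac)
    finally show ?thesis by simp
  qed
  show ?thesis
  proof (rule lambda_alpha_pos_eigenvector[where f = f])
    show "0 < f v" for v using t x c0 x1 by (simp add: f_def)
    show "\<alpha> * real (card {w. (v, w) \<in> parcs ?G}) * f v + (1 - \<alpha>) * (\<Sum>w | (v, w) \<in> parcs ?G. f w) = \<mu> * f v"
      if v: "v \<in> pverts ?G" for v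
    proof -
      have sum_q: "(\<Sum>w = p + 1..p + q. f w) = q" using p by (simp add: f_def)
      consider "v = 1" | "2 \<le> v" "v \<le> p" | "p < v" "v \<le> p + q" | "p + q < v" "v < m" | "v = m"
        using v V by fastforce
      then show ?thesis
      proof cases
        case 1
        have "f (p + q + 1) = g" using p q by (simp add: f_def g_def)
        then have "(\<Sum>w\<in>insert (p + q + 1) {p + 1..p + q}. f w) = q + g"
          using sum_q by simp
        moreover have "card (insert (p + q + 1) {p + 1..p + q}) = q + 1" by simp
        moreover have "f 1 = x1" by (simp add: f_def)
        ultimately show ?thesis using x1eq unfolding 1 out_1 by (simp add: add.commute)
      next
        case 2
        then have "f v = x" by (simp add: f_def)
        then show ?thesis using xeq sum_q unfolding out_p[OF 2] by simp
      next
        case 3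
        have "f v = 1" using 3 p by (simp add: f_def)
        moreover have "(\<Sum>w = 1..p. f w) = x1 + (\<Sum>w = 2..p. f w)"
          using p by (simp add: sum.atLeast_Suc_atMost f_def numeral_2_eq_2)
        moreover have "(\<Sum>w = 2..p. f w) = (real p - 1) * x"
          using p by (simp add: f_def of_nat_diff)
        ultimately show ?thesis using zeq unfolding out_q[OF 3] by simp
      next
        case 4
        then have "m + 1 - v = Suc (m + 1 - (v + 1))" by simp
        then have "f v = t * f (v + 1)" using 4 q p by (simp add: f_def)
        moreover have "\<alpha> * (t * y) + (1 - \<alpha>) * y = \<mu> * (t * y)" for y
          using arg_cong[OF teq, of "\<lambda>s. s * y"] by (simp add: algebra_simps)
        ultimately show ?thesis unfolding out_path[OF 4] by simp
      next
        case 5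
        have "f m = t * c" using m p by (simp add: f_def)
        moreover have "\<alpha> * (t * c) + (1 - \<alpha>) * c = \<mu> * (t * c)"
          using arg_cong[OF teq, of "\<lambda>s. s * c"] by (simp add: algebra_simps)
        ultimately show ?thesis unfolding 5 out_m by (simp add: c')
      qed
    qed
  qed (use G \<alpha> V m in auto)
qed

section \<open>Existence and size of roots of the scalar equation\<close>

text \<open>The intermediate value theorem on the defect: the linear term wins for large
  \<open>\<mu>\<close>, as the bound on \<open>g\<close> keeps the subtracted fractions
  bounded.\<close>

lemma eigen_defect_root:
  fixes \<alpha> l :: real and g :: "real \<Rightarrow> real"
  assumes \<alpha>: "0 \<le> \<alpha>" "\<alpha> < 1" and p: "1 \<le> p" and l: "\<alpha> * (real q + 1) < l"
    and cont: "continuous_on {l..} g" and neg: "eigen_defect \<alpha> p q (g l) l \<le> 0"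
    and g: "\<And>\<mu>::real. l \<le> \<mu> \<Longrightarrow> 2 * real q + 1 \<le> \<mu> \<Longrightarrow> g \<mu> \<le> 1"
  obtains \<mu> where "l \<le> \<mu>" "eigen_defect \<alpha> p q (g \<mu>) \<mu> = 0"
proof -
  \<comment> \<open>The summands dominate, in turn, \<open>\<alpha> * p\<close>, both the
    denominator shifts and the threshold for \<open>g\<close>, and the two fractions, which are at
    most \<open>q + 1\<close> and \<open>p * q\<close>.\<close>
  define u where "u = max l (real p + 2 * real q + 2 + (real q + 1) + real p * real q)"
  have q: "\<alpha> * q \<le> q" "\<alpha> * p \<le> p" "\<alpha> * q \<le> \<alpha> * (real q + 1)" "\<alpha> * (real q + 1) \<le> q + 1"
    using \<alpha> mult_left_le_one_le[of "real q + 1" \<alpha>] by (auto simp: mult_left_le_one_le algebra_simps)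
  have "l \<le> u" and u: "real p + 2 * real q + 2 + (real q + 1) + real p * real q \<le> u"
    by (simp_all add: u_def)
  have pq: "0 \<le> real p * real q" by simp
  have gu: "g u \<le> 1" using \<open>l \<le> u\<close> u pq by (intro g) linarith+
  have b: "(1 - \<alpha>)\<^sup>2 \<le> 1" using \<alpha> by (simp add: power_le_one)
  have frac: "(1 - \<alpha>)\<^sup>2 * a / d \<le> a" if "0 \<le> a" "1 \<le> d" for a d :: real
  proof -
    have "(1 - \<alpha>)\<^sup>2 * a / d \<le> (1 - \<alpha>)\<^sup>2 * a"
      using that mult_left_mono[of 1 d "(1 - \<alpha>)\<^sup>2 * a"] by (simp add: divide_le_eq)
    also have "\<dots> \<le> a" using b that by (simp add: mult_left_le_one_le)
    finally show ?thesis .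
  qed
  have d1: "1 \<le> u - \<alpha> * (real q + 1)" and d2: "1 \<le> u - \<alpha> * q" using u q pq by linarith+
  have "(1 - \<alpha>)\<^sup>2 * (q + g u) / (u - \<alpha> * (real q + 1)) \<le> (1 - \<alpha>)\<^sup>2 * (real q + 1) / (u - \<alpha> * (real q + 1))"
    using gu d1 by (intro divide_right_mono mult_left_mono) auto
  also have "\<dots> \<le> real q + 1" using frac[of "real q + 1" "u - \<alpha> * (real q + 1)"] d1 by simp
  finally have A: "(1 - \<alpha>)\<^sup>2 * (q + g u) / (u - \<alpha> * (real q + 1)) \<le> real q + 1" .
  have B: "(1 - \<alpha>)\<^sup>2 * (real p - 1) * q / (u - \<alpha> * q) \<le> real p * real q"
  proof -
    have "(1 - \<alpha>)\<^sup>2 * ((real p - 1) * q) / (u - \<alpha> * q) \<le> (real p - 1) * q"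
      using d2 p by (intro frac) auto
    also have "\<dots> \<le> real p * real q" by (simp add: algebra_simps)
    finally show ?thesis by (simp only: mult.assoc)
  qed
  have up: "0 \<le> eigen_defect \<alpha> p q (g u) u"
    unfolding eigen_defect_def using A B u q(2) by linarith
  have "continuous_on {l..u} (\<lambda>\<mu>. eigen_defect \<alpha> p q (g \<mu>) \<mu>)"
    unfolding eigen_defect_def
    by (intro continuous_intros continuous_on_subset[OF cont]) (use l q in auto)
  then have "\<exists>\<mu>\<ge>l. \<mu> \<le> u \<and> eigen_defect \<alpha> p q (g \<mu>) \<mu> = 0"
    by (intro IVT') (use neg up \<open>l \<le> u\<close> in auto)
  then show ?thesis using that by blast
qed

text \<open>At this point the first denominator equals \<open>(1 - \<alpha>)\<^sup>2\<close>, so the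
  first fraction is \<open>q + g\<close>, at least 1, whereas \<open>q \<le> p\<close> keeps the
  linear part at most 1.\<close>

lemma eigen_defect_start:
  fixes \<alpha> g :: real
  assumes \<alpha>: "0 \<le> \<alpha>" "\<alpha> < 1" and q: "1 \<le> q" "q \<le> p" and g: "0 \<le> g"
  shows "eigen_defect \<alpha> p q g (\<alpha> * (real q + 1) + (1 - \<alpha>)\<^sup>2) \<le> 0"
proof -
  let ?l = "\<alpha> * (real q + 1) + (1 - \<alpha>)\<^sup>2"
  have b: "0 < (1 - \<alpha>)\<^sup>2" using \<alpha> by simp
  have "\<alpha> * q \<le> \<alpha> * p" using \<alpha> q by (intro mult_left_mono) auto
  moreover have "(1 - \<alpha>)\<^sup>2 \<le> 1 - \<alpha>" using \<alpha> by (simp add: power2_eq_square mult_left_le_one_le)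
  ultimately have "?l - \<alpha> * p \<le> 1" by (simp add: algebra_simps)
  also have "\<dots> \<le> (1 - \<alpha>)\<^sup>2 * (q + g) / (?l - \<alpha> * (real q + 1))" using b q g by simp
  finally have "?l - \<alpha> * p \<le> (1 - \<alpha>)\<^sup>2 * (q + g) / (?l - \<alpha> * (real q + 1))" .
  moreover have "0 \<le> (1 - \<alpha>)\<^sup>2 * (real p - 1) * q / (?l - \<alpha> * q)"
    using b q \<alpha> by (intro divide_nonneg_nonneg mult_nonneg_nonneg) (auto simp: algebra_simps)
  ultimately show ?thesis unfolding eigen_defect_def by linarith
qed

text \<open>A root exceeds the value \<open>\<lambda>\<close> for the bare complete bipartite digraph, for which
  \<open>(\<lambda> - \<alpha>q)(\<lambda> - \<alpha>p) = (1 - \<alpha>)\<^sup>2pq\<close>.\<close>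

lemma eigen_defect_root_bound:
  fixes \<alpha> \<mu> g :: real
  assumes \<alpha>: "0 \<le> \<alpha>" "\<alpha> < 1" and p: "2 \<le> p" and q: "1 \<le> q" and g: "0 \<le> g"
    and \<mu>: "\<alpha> * (real q + 1) < \<mu>" and root: "eigen_defect \<alpha> p q g \<mu> = 0"
  shows "(1 - \<alpha>)\<^sup>2 * q < (\<mu> - \<alpha>) * (\<mu> - \<alpha> * q)"
proof -
  have b: "0 < (1 - \<alpha>)\<^sup>2" using \<alpha> by simp
  have "\<alpha> * q \<le> \<alpha> * (real q + 1)" "\<alpha> * 1 \<le> \<alpha> * p"
    using \<alpha> p by (intro mult_left_mono; simp)+
  then have \<mu>': "0 < \<mu> - \<alpha> * q" and p': "\<alpha> \<le> \<alpha> * p" using \<mu> by linarith+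
  \<comment> \<open>Deleting the path contribution at vertex 1 only lowers its fraction, which then
    merges with that of the other \<open>p - 1\<close> vertices of \<open>V_p\<close>.\<close>
  have "(1 - \<alpha>)\<^sup>2 * q / (\<mu> - \<alpha> * q) \<le> (1 - \<alpha>)\<^sup>2 * (q + g) / (\<mu> - \<alpha> * (real q + 1))"
    using \<mu> \<mu>' g \<alpha> by (intro frac_le mult_left_mono) (auto simp: algebra_simps)
  then have "(1 - \<alpha>)\<^sup>2 * q / (\<mu> - \<alpha> * q) + (1 - \<alpha>)\<^sup>2 * (real p - 1) * q / (\<mu> - \<alpha> * q) \<le> \<mu> - \<alpha> * p"
    using root unfolding eigen_defect_def by linarith
  then have "(1 - \<alpha>)\<^sup>2 * (p * q) / (\<mu> - \<alpha> * q) \<le> \<mu> - \<alpha> * p"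
    unfolding add_divide_distrib[symmetric] by (simp add: algebra_simps)
  also have "\<dots> \<le> \<mu> - \<alpha>" using p' by simp
  finally have "(1 - \<alpha>)\<^sup>2 * (p * q) \<le> (\<mu> - \<alpha>) * (\<mu> - \<alpha> * q)"
    using \<mu>' by (simp add: pos_divide_le_eq)
  \<comment> \<open>Strictness comes from \<open>p\<close> being at least 2.\<close>
  moreover have "(1 - \<alpha>)\<^sup>2 * q < (1 - \<alpha>)\<^sup>2 * (p * q)"
    using b p q by (intro mult_strict_left_mono) auto
  ultimately show ?thesis by linarith
qed

section \<open>Comparison of the two digraphs\<close>

theorem theorem4p7:
  fixes \<alpha> :: real and n p q :: nat
  assumes "0 \<le> \<alpha>" and "\<alpha> < 1"
    and "p \<ge> q" and "q \<ge> 2"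
    and "p + q \<le> n - 2"
  shows "lambda_alpha \<alpha> (B5 (n - 1) p q) > lambda_alpha \<alpha> (B1 n p q)"
proof -
  \<comment> \<open>\<open>k\<close> counts the added vertices of \<open>B5 (n - 1) p q\<close>;
    \<open>B1 n p q\<close> has one more.\<close>
  define k where "k = n - 1 - (p + q)"
  have k: "n - (p + q) = Suc k" and n: "p + q + 1 \<le> n - 1" "p + q + 1 \<le> n"
    using assms by (auto simp: k_def)
  define c where "c \<mu> = (1 - \<alpha>) * q / (\<mu> - \<alpha> * q)" for \<mu> :: real
  let ?g1 = "\<lambda>\<mu>. dipath_weight \<alpha> (Suc k) \<mu> * c \<mu>" and ?g5 = "\<lambda>\<mu>. dipath_weight \<alpha> k \<mu>"
  define l where "l = \<alpha> * (real q + 1) + (1 - \<alpha>)\<^sup>2"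
  have l: "\<alpha> * (real q + 1) < l" using assms by (simp add: l_def)
  have mono: "\<alpha> * q \<le> \<alpha> * (real q + 1)" "\<alpha> \<le> \<alpha> * (real q + 1)" "\<alpha> * q \<le> q"
    using assms by (simp_all add: algebra_simps mult_left_le_one_le)
  have denom: "0 < \<mu> - \<alpha> * q" "0 < \<mu> - \<alpha>" if "l \<le> \<mu>" for \<mu> :: real using that l mono by linarith+
  have weight_pos: "0 < dipath_weight \<alpha> j \<mu>" if "l \<le> \<mu>" for j and \<mu> :: real
    using denom[OF that] assms by (simp add: dipath_weight_def)
  have c_pos: "0 < c \<mu>" if "l \<le> \<mu>" for \<mu> :: real
    using denom[OF that] assms by (simp add: c_def)
  \<comment> \<open>The weights are at most 1 once \<open>1 \<le> \<mu>\<close>, and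
    \<open>c\<close> once \<open>q \<le> \<mu>\<close>; the threshold covers both.\<close>
  have weight_le: "dipath_weight \<alpha> j \<mu> \<le> 1" if "l \<le> \<mu>" "2 * real q + 1 \<le> \<mu>" for j and \<mu> :: real
    using denom[OF that(1)] that(2) assms by (simp add: dipath_weight_def power_le_one)
  have c_le: "c \<mu> \<le> 1" if "l \<le> \<mu>" "2 * real q + 1 \<le> \<mu>" for \<mu> :: real
    using denom[OF that(1)] that(2) by (simp add: c_def divide_le_eq algebra_simps)
  have cont: "continuous_on {l..} (dipath_weight \<alpha> j)" "continuous_on {l..} c" for j
    unfolding dipath_weight_def c_def by (intro continuous_intros ballI; use denom in force)+

  obtain \<mu>1 where \<mu>1: "l \<le> \<mu>1" and root1: "eigen_defect \<alpha> p q (?g1 \<mu>1) \<mu>1 = 0"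
  proof (rule eigen_defect_root[where g = ?g1 and l = l and q = q and p = p and \<alpha> = \<alpha>])
    show "continuous_on {l..} ?g1" by (intro continuous_intros cont)
    show "eigen_defect \<alpha> p q (?g1 l) l \<le> 0"
      unfolding l_def using weight_pos[of l] c_pos[of l] assms
      by (intro eigen_defect_start) (auto simp: l_def[symmetric] intro: less_imp_le)
    show "?g1 \<mu> \<le> 1" if "l \<le> \<mu>" "2 * real q + 1 \<le> \<mu>" for \<mu> :: real
      using weight_le[OF that] c_le[OF that] weight_pos[OF that(1)] c_pos[OF that(1)]
      by (intro mult_le_one) (auto intro: less_imp_le)
  qed (use assms l in auto)
  have L: "\<alpha> * (real q + 1) < \<mu>1" using l \<mu>1 by linarith
  have bound: "(1 - \<alpha>)\<^sup>2 * q < (\<mu>1 - \<alpha>) * (\<mu>1 - \<alpha> * q)"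
    by (rule eigen_defect_root_bound[OF _ _ _ _ _ L root1])
      (use assms weight_pos[OF \<mu>1] c_pos[OF \<mu>1] in \<open>auto intro: less_imp_le\<close>)
  \<comment> \<open>This product is the ratio of the first path entries for \<open>B1\<close> and
    \<open>B5\<close> at \<open>\<mu>1\<close>.\<close>
  have "(1 - \<alpha>) / (\<mu>1 - \<alpha>) * c \<mu>1 < 1"
    using bound denom[OF \<mu>1] by (simp add: c_def divide_simps power2_eq_square mult_ac)
  then have "?g5 \<mu>1 * ((1 - \<alpha>) / (\<mu>1 - \<alpha>) * c \<mu>1) < ?g5 \<mu>1 * 1"
    using weight_pos[OF \<mu>1] by (intro mult_strict_left_mono)
  then have "?g1 \<mu>1 < ?g5 \<mu>1" by (simp add: dipath_weight_def mult_ac)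
  then have "(1 - \<alpha>)\<^sup>2 * (q + ?g1 \<mu>1) / (\<mu>1 - \<alpha> * (real q + 1)) < (1 - \<alpha>)\<^sup>2 * (q + ?g5 \<mu>1) / (\<mu>1 - \<alpha> * (real q + 1))"
    using L assms by (intro divide_strict_right_mono mult_strict_left_mono) auto
  \<comment> \<open>The defect decreases in the path entry, so \<open>\<mu>1\<close> can serve as
    the new left end of the search.\<close>
  then have neg: "eigen_defect \<alpha> p q (?g5 \<mu>1) \<mu>1 < 0"
    using root1 unfolding eigen_defect_def by linarith
  obtain \<mu>5 where \<mu>5: "\<mu>1 \<le> \<mu>5" and root5: "eigen_defect \<alpha> p q (?g5 \<mu>5) \<mu>5 = 0"
  proof (rule eigen_defect_root[where g = ?g5 and l = \<mu>1 and q = q and p = p and \<alpha> = \<alpha>])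
    show "continuous_on {\<mu>1..} ?g5" using continuous_on_subset[OF cont(1)] \<mu>1 by auto
    show "?g5 \<mu> \<le> 1" if "\<mu>1 \<le> \<mu>" "2 * real q + 1 \<le> \<mu>" for \<mu> :: real
      using that \<mu>1 by (intro weight_le) auto
  qed (use assms L neg in auto)
  \<comment> \<open>Each root found yields a positive eigenvector, so it is already the spectral
    radius.\<close>
  have "lambda_alpha \<alpha> (bipartite_dipath n p q p) = \<mu>1"
    by (rule lambda_alpha_bipartite_dipath[where c = "c \<mu>1"])
      (use assms n L root1 in \<open>auto simp: c_def k\<close>)
  moreover have "lambda_alpha \<alpha> (bipartite_dipath (n - 1) p q (p + 1)) = \<mu>5"
    by (rule lambda_alpha_bipartite_dipath[where c = 1])
      (use assms n L \<mu>5 root5 in \<open>auto simp: k_def\<close>)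
  moreover have "\<mu>1 < \<mu>5" using \<mu>5 neg root5 by (cases "\<mu>1 = \<mu>5") auto
  ultimately show ?thesis by (simp add: B1_def B5_def bipartite_dipath_def)
qed

end
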